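(* Let $\ell \geq 1$ and $n_1,\dots,n_\ell \geq 1$ be integers, and let $G = K(n_1, n_2, \dots, n_\ell)$ be the complete $\ell$-partite graph with partite sets $V_1, \dots, V_\ell$, where $|V_i| = n_i$. Then for every positive integer $k$, \[ B(G; k) = \sum_{\substack{j_1 + \cdots + j_\ell = k \\ j_i \geq 1}} \ \prod_{i=1}^{\ell} S(n_i,j_i), \] where the sum is over all $\ell$-tuples $(j_1,\dots,j_\ell)$ of positive integers with sum $k$.
   Context: For a finite simple graph $G=(V,E)$, a proper partition of $G$ is a partition of $V$ into non-empty, pairwise disjoint subsets (parts), each of which is an independent set of $G$ (no two vertices in the same part are adjacent). The graphical Stirling number $B(G;k)$ is the number of proper partitions of $G$ into exactly $k$ parts. $S(n,j)$ denotes the Stirling number of the second kind, i.e. the number of partitions of an $n$-element set into $j$ non-empty subsets. The complete $\ell$-partite graph $K(n_1,\dots,n_\ell)$ has as vertex set the disjoint union of independent sets $V_1,\dots,V_\ell$ with $|V_i|=n_i$, and has all possible edges between different sets $V_i$, $V_j$. *)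

theory Defs
  imports
    "HOL-Library.Disjoint_Sets"
    "HOL-Library.FuncSet"
    "HOL-Combinatorics.Stirling"
    "Graph_Theory.Digraph"
begin

text \<open>
  Finite simple graphs are the symmetric loop-free digraphs without multiple arcs of the locale
  \<^locale>\<open>graph\<close>; adjacency of \<open>u\<close> and \<open>v\<close> is \<open>u \<rightarrow>\<^bsub>G\<^esub> v\<close>.
\<close>

definition independent_set :: "('a, 'b) pre_digraph \<Rightarrow> 'a set \<Rightarrow> bool" where
  "independent_set G S \<longleftrightarrow> S \<subseteq> verts G \<and> (\<forall>u\<in>S. \<forall>v\<in>S. \<not> u \<rightarrow>\<^bsub>G\<^esub> v)"

definition proper_partition :: "('a, 'b) pre_digraph \<Rightarrow> 'a set set \<Rightarrow> bool" where
  "proper_partition G P \<longleftrightarrow> partition_on (verts G) P \<and> (\<forall>S\<in>P. independent_set G S)"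

definition graphical_stirling :: "('a, 'b) pre_digraph \<Rightarrow> nat \<Rightarrow> nat" where
  "graphical_stirling G k = card {P. proper_partition G P \<and> card P = k}"

definition complete_multipartite :: "nat \<Rightarrow> (nat \<Rightarrow> 'a set) \<Rightarrow> ('a, 'b) pre_digraph \<Rightarrow> bool" where
  "complete_multipartite l V G \<longleftrightarrow>
     graph G \<and>
     disjoint_family_on V {1..l} \<and>
     verts G = (\<Union>i\<in>{1..l}. V i) \<and>
     arcs_ends G = {(u, v). \<exists>i\<in>{1..l}. \<exists>j\<in>{1..l}. i \<noteq> j \<and> u \<in> V i \<and> v \<in> V j}"

text \<open>
  \<^const>\<open>Stirling\<close> is defined by its recurrence; the following lemma
  identifies it with the number of partitions into a given number of non-empty parts.
\<close>

lemma card_partition_on_insert: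
  assumes fin: "finite A" and a: "a \<notin> A"
  shows "card {P. partition_on (insert a A) P \<and> card P = Suc k} =
         Suc k * card {P. partition_on A P \<and> card P = Suc k} + card {P. partition_on A P \<and> card P = k}"
proof -
  define S where "S = (\<lambda>k. {P. partition_on A P \<and> card P = k})"
  define T1 where "T1 = {P. partition_on (insert a A) P \<and> card P = Suc k \<and> {a} \<in> P}"
  define T2 where "T2 = {P. partition_on (insert a A) P \<and> card P = Suc k \<and> {a} \<notin> P}"
  have finS: "finite (S j)" for j
    unfolding S_def by (rule finite_subset[OF _ finitely_many_partition_on[OF fin]]) auto
  have finT: "finite T1" "finite T2"
    unfolding T1_def T2_def
    by (rule finite_subset[OF _ finitely_many_partition_on[of "insert a A"]]; use fin in auto)+
  have finP: "finite P" if "partition_on A P" for P using finite_elements[OF fin that] .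
  have finQ: "finite Q" if "partition_on (insert a A) Q" for Q
    using finite_elements[OF _ that] fin by simp
  have "{P. partition_on (insert a A) P \<and> card P = Suc k} = T1 \<union> T2" "T1 \<inter> T2 = {}"
    by (auto simp: T1_def T2_def)
  then have *: "card {P. partition_on (insert a A) P \<and> card P = Suc k} = card T1 + card T2"
    using finT by (simp add: card_Un_disjoint)
  have notin: "a \<notin> p" if "partition_on A P" "p \<in> P" for P p
    using that a by (auto simp: partition_on_def)
  have "bij_betw (insert {a}) (S k) T1"
  proof (rule bij_betw_byWitness[where f' = "\<lambda>Q. Q - {{a}}"])
    show "\<forall>P\<in>S k. insert {a} P - {{a}} = P" using notin by (auto simp: S_def)
    show "\<forall>Q\<in>T1. insert {a} (Q - {{a}}) = Q" by (auto simp: T1_def)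
    show "insert {a} ` S k \<subseteq> T1"
    proof (clarsimp simp: T1_def S_def, intro conjI)
      fix P assume P: "partition_on A P" "k = card P"
      have "{a} \<notin> P" using notin P by blast
      then show "card (insert {a} P) = Suc (card P)" using finP[OF P(1)] by simp
      show "partition_on (insert a A) (insert {a} P)"
        using P a by (auto simp: partition_on_def disjoint_def)
    qed
    show "(\<lambda>Q. Q - {{a}}) ` T1 \<subseteq> S k"
    proof (rule image_subsetI)
      fix Q assume "Q \<in> T1"
      then have Q: "\<Union>Q = insert a A" "disjoint Q" "{} \<notin> Q" "card Q = Suc k" "{a} \<in> Q"
        by (simp_all add: T1_def partition_on_def)
      have n: "a \<notin> \<Union>(Q - {{a}})" using disjointD[OF Q(2) Q(5)] by fastforce
      have "\<Union>Q = insert a (\<Union>(Q - {{a}}))" using Q(5) by auto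
      then have "\<Union>(Q - {{a}}) = A" using Q(1) n a by (metis insert_ident)
      moreover have "disjoint (Q - {{a}})" using Q(2) by (rule pairwise_subset) simp
      ultimately show "Q - {{a}} \<in> S k" using Q by (simp add: S_def partition_on_def)
    qed
  qed
  then have 1: "card T1 = card (S k)" by (simp add: bij_betw_same_card)
  define f where "f = (\<lambda>(P, p). insert (insert a p) (P - {p}))"
  have "bij_betw f (SIGMA P:S (Suc k). P) T2"
  proof (rule bij_betw_imageI)
    show "inj_on f (SIGMA P:S (Suc k). P)"
    proof (rule inj_onI, clarify)
      fix P p P' p'
      assume P: "P \<in> S (Suc k)" "p \<in> P" and P': "P' \<in> S (Suc k)" "p' \<in> P'"
        and eq: "f (P, p) = f (P', p')"
      have n: "\<And>q. q \<in> P \<Longrightarrow> a \<notin> q" "\<And>q. q \<in> P' \<Longrightarrow> a \<notin> q"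
        using P P' notin by (auto simp: S_def)
      have "{q \<in> f (P, p). a \<in> q} = {insert a p}" "{q \<in> f (P', p'). a \<in> q} = {insert a p'}"
        using n by (auto simp: f_def)
      then have "insert a p = insert a p'" using eq by auto
      then have pp: "p = p'" using n P P' by (metis insert_ident)
      have "{q \<in> f (P, p). a \<notin> q} = P - {p}" "{q \<in> f (P', p'). a \<notin> q} = P' - {p'}"
        using n by (auto simp: f_def)
      then have "P - {p} = P' - {p'}" using eq by auto
      then show "P = P' \<and> p = p'" using pp P P' by (metis insert_Diff)
    qed
    show "f ` (SIGMA P:S (Suc k). P) = T2"
    proof (intro equalityI subsetI)
      fix Q assume "Q \<in> f ` (SIGMA P:S (Suc k). P)"
      then obtain P p where P: "partition_on A P" "card P = Suc k" "p \<in> P"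
        and Q: "Q = insert (insert a p) (P - {p})" by (auto simp: f_def S_def)
      have n: "\<And>q. q \<in> P \<Longrightarrow> a \<notin> q" using P notin by auto
      have "insert a p \<notin> P - {p}" using n by auto
      then have "card Q = Suc k" using P Q finP[OF P(1)] by simp
      moreover have "{a} \<notin> Q"
      proof -
        have "p \<noteq> {}" "a \<notin> p" "{a} \<notin> P" using P n[OF P(3)] n by (auto simp: partition_on_def)
        then show ?thesis using Q by (auto simp: insert_eq_iff)
      qed
      moreover have "partition_on (insert a A) Q"
        unfolding partition_on_def
      proof (intro conjI)
        show "\<Union>Q = insert a A" using P Q by (auto simp: partition_on_def)
        show "{} \<notin> Q" using P Q by (auto simp: partition_on_def)
        show "disjoint Q" proof (rule disjointI)
          fix r r' assume r: "r \<in> Q" "r' \<in> Q" "r \<noteq> r'"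
          have d: "\<And>q q'. q \<in> P \<Longrightarrow> q' \<in> P \<Longrightarrow> q \<noteq> q' \<Longrightarrow> q \<inter> q' = {}"
            using P(1) disjointD unfolding partition_on_def by blast
          show "r \<inter> r' = {}"
          proof (cases "r = insert a p")
            case True
            then show ?thesis using r Q n d[OF P(3), of r'] by auto
          next
            case False
            then have "r \<in> P" "r \<noteq> p" using r Q by auto
            then show ?thesis using r Q n[of r] d[of r r'] d[of r p] P(3) by auto
          qed
        qed
      qed
      ultimately show "Q \<in> T2" by (simp add: T2_def)
    next
      fix Q assume "Q \<in> T2"
      then have Q: "partition_on (insert a A) Q" "card Q = Suc k" "{a} \<notin> Q"
        by (auto simp: T2_def)
      obtain q where q: "q \<in> Q" "a \<in> q" using Q(1) by (auto simp: partition_on_def)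
      define p where "p = q - {a}"
      define P where "P = insert p (Q - {q})"
      have qp: "q = insert a p" "a \<notin> p" using q by (auto simp: p_def)
      have pne: "p \<noteq> {}" using qp Q q by auto
      have pd: "r \<inter> q = {}" if "r \<in> Q" "r \<noteq> q" for r
        using Q(1) q that by (auto simp: partition_on_def disjoint_def)
      have pn: "p \<notin> Q" using pd[of p] pne qp by auto
      have "card P = Suc k"
        using finQ[OF Q(1)] Q(2) pn q by (simp add: P_def)
      moreover have "partition_on A P"
        unfolding partition_on_def
      proof (intro conjI)
        have "insert a A = \<Union>Q" using Q(1) by (simp add: partition_on_def)
        also have "\<dots> = insert a (\<Union>P)" using q qp by (auto simp: P_def)
        finally have "insert a A = insert a (\<Union>P)" .
        moreover have "a \<notin> \<Union>P" using pd q qp by (auto simp: P_def)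
        ultimately show "\<Union>P = A" using a by (metis insert_ident)
        show "{} \<notin> P" using Q(1) pne by (auto simp: P_def partition_on_def)
        show "disjoint P"
        proof (rule disjointI)
          fix r r' assume r: "r \<in> P" "r' \<in> P" "r \<noteq> r'"
          have "r \<inter> r' = {}" if "r \<in> Q" "r' \<in> Q"
            using Q(1) that r(3) disjointD unfolding partition_on_def by blast
          moreover have "p \<subseteq> q" using qp by auto
          ultimately show "r \<inter> r' = {}" using r pd[of r] pd[of r'] by (auto simp: P_def)
        qed
      qed
      moreover have "f (P, p) = Q" using pn q qp by (auto simp: f_def P_def)
      ultimately show "Q \<in> f ` (SIGMA P:S (Suc k). P)"
        by (intro image_eqI[of _ _ "(P, p)"]) (auto simp: S_def P_def)
    qed
  qed
  then have "card T2 = card (SIGMA P:S (Suc k). P)" by (simp add: bij_betw_same_card)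
  also have "\<dots> = (\<Sum>P\<in>S (Suc k). card P)"
    using finS finP by (intro card_SigmaI) (auto simp: S_def)
  also have "\<dots> = Suc k * card (S (Suc k))" by (simp add: S_def)
  finally show ?thesis using * 1 by (simp add: S_def)
qed

lemma Stirling_eq_card_partition_on:
  assumes "finite A"
  shows "Stirling (card A) k = card {P. partition_on A P \<and> card P = k}"
  using assms
proof (induction A arbitrary: k rule: finite_induct)
  case empty
  have "{P. partition_on ({} :: 'a set) P \<and> card P = k} = (if k = 0 then {{}} else {})"
    by (auto simp: partition_on_empty)
  then show ?case by (cases k) (simp_all only:, simp_all)
next
  case (insert a A)
  show ?case
  proof (cases k)
    case 0
    have "{P. partition_on (insert a A) P \<and> card P = 0} = {}"
    proof -
      have "card P \<noteq> 0" if P: "partition_on (insert a A) P" for P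
      proof -
        have "finite P" using finite_elements[OF _ P] insert.hyps(1) by simp
        moreover have "P \<noteq> {}" using partition_onD1[OF P] by auto
        ultimately show ?thesis by simp
      qed
      then show ?thesis by blast
    qed
    then show ?thesis using 0 insert.hyps by (simp only: card_insert_disjoint) simp
  next
    case (Suc m)
    show ?thesis
      using insert.hyps card_partition_on_insert[OF insert.hyps(1,2), of m]
      by (simp add: Suc insert.IH[symmetric])
  qed
qed

end

theory Submission
  imports Defs
begin

text \<open>
  In a complete multipartite graph the non-empty independent sets are exactly the non-empty
  subsets of the partite sets (\<open>complete_multipartite_independent_set_iff\<close>): two vertices from
  different partite sets are always adjacent, two from the same one never. A proper partition
  therefore refines the partition into partite sets, and so amounts to an independent choice of a
  partition of each \<open>V i\<close> (\<open>bij_betw_partition_on_UN\<close>); its number of parts is the sum of the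
  numbers of parts of the pieces. Sorting these choices by the tuple of part numbers
  (\<open>card_PiE_sum_eq\<close>) gives a sum, over tuples with sum \<open>k\<close>, of products of numbers of set
  partitions, which are Stirling numbers. The tuples have positive entries because every
  partition of a non-empty set has at least one part.
\<close>

text \<open>
  This is the combinatorial form of multiplying \<open>card I\<close> generating functions: a choice function
  of total weight \<open>k\<close> is classified by the weights \<open>j i\<close> of its entries, and for fixed \<open>j\<close> the
  entries are chosen independently. The set \<open>B\<close> is any set known to contain all weights;
  requiring it of the \<open>j i\<close> only discards tuples that contribute nothing.
\<close>

lemma card_PiE_sum_eq:
  fixes w :: "'b \<Rightarrow> nat"
  assumes I: "finite I" and A: "\<And>i. i \<in> I \<Longrightarrow> finite (A i)"
    and B: "\<And>i x. i \<in> I \<Longrightarrow> x \<in> A i \<Longrightarrow> w x \<in> B"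
  shows "card {F \<in> Pi\<^sub>E I A. (\<Sum>i\<in>I. w (F i)) = k} =
    (\<Sum>j \<in> {j \<in> I \<rightarrow>\<^sub>E B. (\<Sum>i\<in>I. j i) = k}. \<Prod>i\<in>I. card {x \<in> A i. w x = j i})"
proof -
  define J where "J = {j \<in> I \<rightarrow>\<^sub>E B. (\<Sum>i\<in>I. j i) = k}"
  define C where "C = (\<lambda>j. \<Pi>\<^sub>E i\<in>I. {x \<in> A i. w x = j i})"
  have "j i \<le> k" if "j \<in> J" "i \<in> I" for i j
    using that I member_le_sum[of i I j] by (simp add: J_def)
  moreover have "j \<in> extensional I" if "j \<in> J" for j
    using that by (simp add: J_def PiE_iff)
  ultimately have "J \<subseteq> I \<rightarrow>\<^sub>E {..k}"
    by (simp add: PiE_iff subset_iff)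
  moreover have "finite (I \<rightarrow>\<^sub>E {..k})"
    using I by (intro finite_PiE) auto
  ultimately have J: "finite J" by (rule finite_subset)
  have fin: "finite (C j)" for j
    unfolding C_def using I A by (intro finite_PiE) auto
  have disj: "C j \<inter> C j' = {}" if j: "j \<in> J" "j' \<in> J" "j \<noteq> j'" for j j'
  proof (rule ccontr)
    assume "C j \<inter> C j' \<noteq> {}"
    then obtain F where "F \<in> C j" "F \<in> C j'" by auto
    then have "j i = j' i" if "i \<in> I" for i
      using that by (auto simp: C_def PiE_iff)
    moreover have "j \<in> I \<rightarrow>\<^sub>E B" "j' \<in> I \<rightarrow>\<^sub>E B"
      using j by (simp_all add: J_def)
    ultimately show False using j(3) PiE_ext by blast
  qed
  have "{F \<in> Pi\<^sub>E I A. (\<Sum>i\<in>I. w (F i)) = k} = (\<Union>j\<in>J. C j)"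
  proof (intro equalityI subsetI)
    fix F assume F: "F \<in> {F \<in> Pi\<^sub>E I A. (\<Sum>i\<in>I. w (F i)) = k}"
    then have "(\<lambda>i\<in>I. w (F i)) \<in> J" using B by (auto simp: J_def PiE_iff)
    moreover have "F \<in> C (\<lambda>i\<in>I. w (F i))" using F by (auto simp: C_def PiE_iff)
    ultimately show "F \<in> (\<Union>j\<in>J. C j)" by blast
  next
    fix F assume "F \<in> (\<Union>j\<in>J. C j)"
    then obtain j where j: "j \<in> J" "F \<in> C j" by blast
    have "(\<Sum>i\<in>I. w (F i)) = (\<Sum>i\<in>I. j i)"
      using j by (intro sum.cong) (auto simp: C_def PiE_iff)
    then show "F \<in> {F \<in> Pi\<^sub>E I A. (\<Sum>i\<in>I. w (F i)) = k}"
      using j by (auto simp: C_def J_def PiE_iff)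
  qed
  then have "card {F \<in> Pi\<^sub>E I A. (\<Sum>i\<in>I. w (F i)) = k} = (\<Sum>j\<in>J. card (C j))"
    using J fin disj by (simp add: card_UN_disjoint)
  also have "\<dots> = (\<Sum>j\<in>J. \<Prod>i\<in>I. card {x \<in> A i. w x = j i})"
    using I by (simp add: C_def card_PiE)
  finally show ?thesis by (simp add: J_def)
qed

text \<open>
  The pieces of a partition that refines a disjoint family can be read off again: the partition
  of \<open>V i\<close> consists of the parts inside \<open>V i\<close>. Since parts are non-empty, no part lies inside
  two members of the family.
\<close>

lemma parts_UN_within:
  assumes disj: "disjoint_family_on V I"
    and F: "\<And>i. i \<in> I \<Longrightarrow> partition_on (V i) (F i)" and i: "i \<in> I"
  shows "{S \<in> (\<Union>i\<in>I. F i). S \<subseteq> V i} = F i"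
proof (intro equalityI subsetI)
  fix S assume "S \<in> {S \<in> (\<Union>i\<in>I. F i). S \<subseteq> V i}"
  then obtain m where m: "m \<in> I" "S \<in> F m" "S \<subseteq> V i" by blast
  have "S \<subseteq> V m" "S \<noteq> {}"
    using F[OF m(1)] m(2) by (auto simp: partition_on_def)
  then have "m = i"
    using disjoint_family_onD[OF disj m(1) i] m(3) by blast
  then show "S \<in> F i" using m by simp
next
  fix S assume "S \<in> F i"
  then show "S \<in> {S \<in> (\<Union>i\<in>I. F i). S \<subseteq> V i}"
    using F[OF i] i by (auto simp: partition_on_def)
qed

lemma bij_betw_partition_on_UN:
  assumes disj: "disjoint_family_on V I"
  shows "bij_betw (\<lambda>F. \<Union>i\<in>I. F i) (\<Pi>\<^sub>E i\<in>I. {P. partition_on (V i) P})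
    {P. partition_on (\<Union>i\<in>I. V i) P \<and> (\<forall>S\<in>P. \<exists>i\<in>I. S \<subseteq> V i)}"
proof (rule bij_betw_byWitness[where f' = "\<lambda>P. \<lambda>i\<in>I. {S \<in> P. S \<subseteq> V i}"])
  show "\<forall>F\<in>\<Pi>\<^sub>E i\<in>I. {P. partition_on (V i) P}.
      (\<lambda>i\<in>I. {S \<in> (\<Union>i\<in>I. F i). S \<subseteq> V i}) = F"
  proof
    fix F assume F: "F \<in> (\<Pi>\<^sub>E i\<in>I. {P. partition_on (V i) P})"
    then have "{S \<in> (\<Union>i\<in>I. F i). S \<subseteq> V i} = F i" if "i \<in> I" for i
      by (intro parts_UN_within[OF disj _ that]) (auto simp: PiE_iff)
    then show "(\<lambda>i\<in>I. {S \<in> (\<Union>i\<in>I. F i). S \<subseteq> V i}) = F"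
      using PiE_arb[OF F] by (intro ext) (simp add: restrict_def)
  qed
  show "\<forall>P\<in>{P. partition_on (\<Union>i\<in>I. V i) P \<and> (\<forall>S\<in>P. \<exists>i\<in>I. S \<subseteq> V i)}.
      (\<Union>i\<in>I. (\<lambda>i\<in>I. {S \<in> P. S \<subseteq> V i}) i) = P"
    by auto
  show "(\<lambda>F. \<Union>i\<in>I. F i) ` (\<Pi>\<^sub>E i\<in>I. {P. partition_on (V i) P})
      \<subseteq> {P. partition_on (\<Union>i\<in>I. V i) P \<and> (\<forall>S\<in>P. \<exists>i\<in>I. S \<subseteq> V i)}"
  proof (rule image_subsetI)
    fix F assume "F \<in> (\<Pi>\<^sub>E i\<in>I. {P. partition_on (V i) P})"
    then have F: "partition_on (V i) (F i)" if "i \<in> I" for i using that by auto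
    have "partition_on (\<Union>i\<in>I. V i) (\<Union>i\<in>I. F i)"
    proof (rule partition_onI)
      show "\<Union>(\<Union>i\<in>I. F i) = (\<Union>i\<in>I. V i)"
        using partition_onD1[OF F] by auto
      show "{} \<notin> (\<Union>i\<in>I. F i)"
        using partition_onD3[OF F] by blast
    next
      fix p q assume pq: "p \<in> (\<Union>i\<in>I. F i)" "q \<in> (\<Union>i\<in>I. F i)" "p \<noteq> q"
      then obtain i m where im: "i \<in> I" "m \<in> I" "p \<in> F i" "q \<in> F m" by blast
      show "disjnt p q"
      proof (cases "i = m")
        case True
        then show ?thesis
          using F[OF im(1)] im pq(3) by (auto simp: partition_on_def disjnt_def disjoint_def)
      next
        case False
        then have "V i \<inter> V m = {}" using disj im by (auto simp: disjoint_family_on_def)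
        moreover have "p \<subseteq> V i" "q \<subseteq> V m"
          using F im by (auto simp: partition_on_def)
        ultimately show ?thesis by (auto simp: disjnt_def)
      qed
    qed
    moreover have "\<forall>S\<in>(\<Union>i\<in>I. F i). \<exists>i\<in>I. S \<subseteq> V i"
      using F by (auto simp: partition_on_def)
    ultimately show "(\<Union>i\<in>I. F i)
        \<in> {P. partition_on (\<Union>i\<in>I. V i) P \<and> (\<forall>S\<in>P. \<exists>i\<in>I. S \<subseteq> V i)}"
      by blast
  qed
  show "(\<lambda>P. \<lambda>i\<in>I. {S \<in> P. S \<subseteq> V i})
      ` {P. partition_on (\<Union>i\<in>I. V i) P \<and> (\<forall>S\<in>P. \<exists>i\<in>I. S \<subseteq> V i)}
      \<subseteq> (\<Pi>\<^sub>E i\<in>I. {P. partition_on (V i) P})"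
  proof (rule image_subsetI)
    fix P assume "P \<in> {P. partition_on (\<Union>i\<in>I. V i) P \<and> (\<forall>S\<in>P. \<exists>i\<in>I. S \<subseteq> V i)}"
    then have P: "partition_on (\<Union>i\<in>I. V i) P"
      and ref: "\<And>S. S \<in> P \<Longrightarrow> \<exists>i\<in>I. S \<subseteq> V i" by auto
    have "partition_on (V i) {S \<in> P. S \<subseteq> V i}" if i: "i \<in> I" for i
    proof (rule partition_onI)
      show "\<Union>{S \<in> P. S \<subseteq> V i} = V i"
      proof (intro equalityI subsetI)
        fix x assume x: "x \<in> V i"
        then obtain S where S: "S \<in> P" "x \<in> S"
          using partition_onD1[OF P] i by blast
        then obtain m where m: "m \<in> I" "S \<subseteq> V m" using ref by blast
        \<comment> \<open>\<open>V i\<close> and \<open>V m\<close> share \<open>x\<close>\<close>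
        then have "m = i" using disjoint_family_onD[OF disj m(1) i] x S by blast
        then show "x \<in> \<Union>{S \<in> P. S \<subseteq> V i}" using S m by blast
      qed auto
      show "{} \<notin> {S \<in> P. S \<subseteq> V i}"
        using partition_onD3[OF P] by blast
      show "disjnt p q" if "p \<in> {S \<in> P. S \<subseteq> V i}" "q \<in> {S \<in> P. S \<subseteq> V i}" "p \<noteq> q" for p q
        using that P by (auto simp: partition_on_def disjnt_def disjoint_def)
    qed
    then show "(\<lambda>i\<in>I. {S \<in> P. S \<subseteq> V i}) \<in> (\<Pi>\<^sub>E i\<in>I. {P. partition_on (V i) P})"
      by auto
  qed
qed

lemma card_UN_partition_on:
  assumes I: "finite I" and V: "\<And>i. i \<in> I \<Longrightarrow> finite (V i)"
    and disj: "disjoint_family_on V I"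
    and F: "\<And>i. i \<in> I \<Longrightarrow> partition_on (V i) (F i)"
  shows "card (\<Union>i\<in>I. F i) = (\<Sum>i\<in>I. card (F i))"
proof (rule card_UN_disjoint[OF I])
  show "\<forall>i\<in>I. finite (F i)" using V F by (blast intro: finite_elements)
  show "\<forall>i\<in>I. \<forall>m\<in>I. i \<noteq> m \<longrightarrow> F i \<inter> F m = {}"
  proof (intro ballI impI)
    fix i m assume im: "i \<in> I" "m \<in> I" "i \<noteq> m"
    \<comment> \<open>A common part would be contained in \<open>V i \<inter> V m = {}\<close>, but parts are non-empty.\<close>
    have "S = {}" if "S \<in> F i" "S \<in> F m" for S
    proof -
      have "S \<subseteq> V i" "S \<subseteq> V m"
        using partition_onD1[OF F] im that by blast+
      then show ?thesis using disjoint_family_onD[OF disj im] by blast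
    qed
    moreover have "{} \<notin> F i" using F[OF im(1)] by (simp add: partition_on_def)
    ultimately show "F i \<inter> F m = {}" by blast
  qed
qed

lemma complete_multipartite_independent_set_iff:
  assumes G: "complete_multipartite l V G" and S: "S \<noteq> {}"
  shows "independent_set G S \<longleftrightarrow> (\<exists>i\<in>{1..l}. S \<subseteq> V i)"
proof -
  have arc_iff: "(u, v) \<in> arcs_ends G \<longleftrightarrow>
      (\<exists>i\<in>{1..l}. \<exists>j\<in>{1..l}. i \<noteq> j \<and> u \<in> V i \<and> v \<in> V j)" for u v
    using G by (simp add: complete_multipartite_def)
  have "\<exists>i\<in>{1..l}. S \<subseteq> V i" if ind: "independent_set G S"
  proof -
    have sub: "S \<subseteq> (\<Union>i\<in>{1..l}. V i)"
      using G ind by (simp add: independent_set_def complete_multipartite_def)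
    obtain u where u: "u \<in> S" using S by blast
    then obtain i where i: "i \<in> {1..l}" "u \<in> V i" using sub by blast
    have "v \<in> V i" if v: "v \<in> S" for v
    proof -
      obtain m where m: "m \<in> {1..l}" "v \<in> V m" using sub v by blast
      have "(u, v) \<notin> arcs_ends G" using ind u v by (simp add: independent_set_def)
      then have "m = i" using arc_iff i m by metis
      then show ?thesis using m by simp
    qed
    then show ?thesis using i by blast
  qed
  moreover have "independent_set G S" if i: "i \<in> {1..l}" "S \<subseteq> V i" for i
  proof -
    have disj: "disjoint_family_on V {1..l}"
      using G by (simp add: complete_multipartite_def)
    have "(u, v) \<notin> arcs_ends G" if uv: "u \<in> S" "v \<in> S" for u v
    proof
      assume "(u, v) \<in> arcs_ends G"
      then obtain a b where ab: "a \<in> {1..l}" "b \<in> {1..l}" "a \<noteq> b" "u \<in> V a" "v \<in> V b"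
        using arc_iff by metis
      have "a = i"
        using disjoint_family_onD[OF disj ab(1) i(1)] ab(4) i(2) uv(1) by blast
      moreover have "b = i"
        using disjoint_family_onD[OF disj ab(2) i(1)] ab(5) i(2) uv(2) by blast
      ultimately show False using ab(3) by simp
    qed
    moreover have "S \<subseteq> verts G"
      using G i by (auto simp: complete_multipartite_def)
    ultimately show ?thesis by (simp add: independent_set_def)
  qed
  ultimately show ?thesis by blast
qed

theorem theorem1:
  fixes G :: "('a, 'b) pre_digraph"
    and V :: "nat \<Rightarrow> 'a set"
    and n :: "nat \<Rightarrow> nat"
    and l k :: nat
  assumes "l \<ge> 1"
    and "\<And>i. i \<in> {1..l} \<Longrightarrow> n i \<ge> 1"
    and "complete_multipartite l V G"
    and "\<And>i. i \<in> {1..l} \<Longrightarrow> card (V i) = n i"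
    and "k \<ge> 1"
  shows "graphical_stirling G k =
    (\<Sum>j \<in> {j \<in> {1..l} \<rightarrow>\<^sub>E {1..}. (\<Sum>i\<in>{1..l}. j i) = k}. \<Prod>i\<in>{1..l}. Stirling (n i) (j i))"
proof -
  let ?I = "{1..l}"
  let ?A = "\<lambda>i. {P. partition_on (V i) P}"
  let ?union = "\<lambda>F. \<Union>i\<in>?I. F i"
  have disj: "disjoint_family_on V ?I" and verts: "verts G = (\<Union>i\<in>?I. V i)"
    using assms(3) by (simp_all add: complete_multipartite_def)
  have V: "finite (V i)" "V i \<noteq> {}" if "i \<in> ?I" for i
  proof -
    have "card (V i) > 0" using assms(2,4)[OF that] by simp
    then show "finite (V i)" "V i \<noteq> {}" by (simp_all add: card_gt_0_iff)
  qed
  have pos: "card P \<in> {1..}" if i: "i \<in> ?I" and P: "P \<in> ?A i" for i P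
  proof -
    have "finite P" using P V(1)[OF i] by (auto intro: finite_elements)
    moreover have "P \<noteq> {}" using P V(2)[OF i] by (auto simp: partition_on_def)
    ultimately show ?thesis by (simp add: Suc_le_eq card_gt_0_iff)
  qed
  have proper: "{P. proper_partition G P} =
      {P. partition_on (\<Union>i\<in>?I. V i) P \<and> (\<forall>S\<in>P. \<exists>i\<in>?I. S \<subseteq> V i)}"
  proof -
    have "(\<forall>S\<in>P. independent_set G S) \<longleftrightarrow> (\<forall>S\<in>P. \<exists>i\<in>?I. S \<subseteq> V i)"
      if "partition_on (\<Union>i\<in>?I. V i) P" for P
    proof (rule ball_cong[OF refl])
      fix S assume "S \<in> P"
      then have "S \<noteq> {}" using partition_onD3[OF that] by blast
      then show "independent_set G S \<longleftrightarrow> (\<exists>i\<in>?I. S \<subseteq> V i)"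
        by (rule complete_multipartite_independent_set_iff[OF assms(3)])
    qed
    then show ?thesis unfolding proper_partition_def verts by blast
  qed
  have bij: "bij_betw ?union (Pi\<^sub>E ?I ?A) {P. proper_partition G P}"
    unfolding proper by (rule bij_betw_partition_on_UN[OF disj])
  have parts: "card (?union F) = (\<Sum>i\<in>?I. card (F i))" if "F \<in> Pi\<^sub>E ?I ?A" for F
    using that V(1) disj by (intro card_UN_partition_on) auto
  have "bij_betw ?union {F \<in> Pi\<^sub>E ?I ?A. (\<Sum>i\<in>?I. card (F i)) = k}
      {P. proper_partition G P \<and> card P = k}"
  proof (rule bij_betw_subset[OF bij])
    have "{P. proper_partition G P \<and> card P = k} = {P \<in> ?union ` Pi\<^sub>E ?I ?A. card P = k}"
      using bij by (simp add: bij_betw_def)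
    also have "\<dots> = ?union ` {F \<in> Pi\<^sub>E ?I ?A. (\<Sum>i\<in>?I. card (F i)) = k}"
      using parts by auto
    finally show "?union ` {F \<in> Pi\<^sub>E ?I ?A. (\<Sum>i\<in>?I. card (F i)) = k} =
      {P. proper_partition G P \<and> card P = k}" by simp
  qed auto
  then have "graphical_stirling G k = card {F \<in> Pi\<^sub>E ?I ?A. (\<Sum>i\<in>?I. card (F i)) = k}"
    by (simp add: graphical_stirling_def bij_betw_same_card)
  also have "\<dots> = (\<Sum>j \<in> {j \<in> ?I \<rightarrow>\<^sub>E {1..}. (\<Sum>i\<in>?I. j i) = k}.
      \<Prod>i\<in>?I. card {P \<in> ?A i. card P = j i})"
    using V(1) pos by (intro card_PiE_sum_eq) (auto intro: finitely_many_partition_on)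
  also have "\<dots> = (\<Sum>j \<in> {j \<in> ?I \<rightarrow>\<^sub>E {1..}. (\<Sum>i\<in>?I. j i) = k}.
      \<Prod>i\<in>?I. Stirling (n i) (j i))"
  proof (intro sum.cong prod.cong refl)
    fix j i assume i: "i \<in> ?I"
    show "card {P \<in> ?A i. card P = j i} = Stirling (n i) (j i)"
      using Stirling_eq_card_partition_on[OF V(1)[OF i], of "j i"] assms(4)[OF i] by simp
  qed
  finally show ?thesis .
qed

end
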